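(* Let $M$ be the Hardy--Littlewood maximal operator associated with the family $\mathcal R$ of admissible trapezoids (with parameter $\beta\ge 12$) on a tree $T$ rooted at infinity with vertex set $V$ and endowed with a locally doubling flow measure $m$. Then the following hold. (i) For all $f\in L^1(m)$ and $\lambda>0$, $$m(\{x\in V:\ Mf(x)>\lambda\})\le \frac{2\beta}{\lambda}\|f\|_1 .$$ (ii) For every $p\in(1,+\infty)$, $M$ is bounded on $L^p(m)$ with constant (operator norm) at most $2\left(2\beta\frac{p}{p-1}\right)^{1/p}$.
   Context: Tree with root at infinity: $T=(V,E)$ is an (undirected) tree with geodesic distance $d$, $o\in V$ is a fixed origin, and $g$ is a fixed half-infinite geodesic starting at $o$, identified with a boundary point $\zeta_g$, the root. For $x\in V$ let $\Pi(x)$ be the vertex of $g$ closest to $x$; the level of $x$ is $\ell(x)=d(o,\Pi(x))-d(\Pi(x),x)$. Write $x\ge y$ iff $\ell(x)-\ell(y)=d(x,y)$. The predecessor $p(x)$ is the unique neighbour of $x$ with level $\ell(x)+1$; the set of sons is $s(x)=\{y\sim x:\ \ell(y)=\ell(x)-1\}$, and $q(x)=|s(x)|$. Flow measure: a function $m:V\to(0,\infty)$ with $m(x)=\sum_{y\in s(x)}m(y)$ for all $x\in V$; it is also regarded as the measure $m(A)=\sum_{x\in A}m(x)$. It is locally doubling if for every $r>0$ there is $C_r>1$ with $m(B_{2r}(x))\le C_r m(B_r(x))$ for all $x\in V$, where $B_r(x)=\{y: d(x,y)\le r\}$. $L^p(m)$ is the usual Lebesgue space, and $\int_A f\,dm=\sum_{y\in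 A}f(y)m(y)$. Admissible trapezoids: for integers $h''>h'\ge1$ and $x_0\in V$, $R_{h'}^{h''}(x_0)=\{x\in V:\ x\le x_0,\ \ell(x_0)-h''<\ell(x)\le \ell(x_0)-h'\}$. Fix $\beta\ge12$. $\mathcal R$ is the family of all singletons $\{x_0\}$ and all $R_{h'}^{h''}(x_0)$ with $2\le h''/h'\le\beta$, $x_0\in V$. Maximal function: $Mf(x)=\sup\frac1{m(R)}\int_R|f|\,dm$, the supremum over all $R\in\mathcal R$ with $x\in R$. *)

theory Defs
  imports "HOL-Analysis.Analysis"
begin

text \<open>
  The vertex set is a whole type \<open>'v\<close>; an undirected graph on it is given by its symmetric,
  irreflexive adjacency relation \<open>E\<close>. The predicate \<open>tree\<close> of the AFP entry on
  directed graphs is not suitable: it excludes directed cycles only, and a symmetric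
  digraph has a directed cycle of length two along every edge.
\<close>

definition is_cycle :: "('v \<times> 'v) set \<Rightarrow> 'v list \<Rightarrow> bool" where
  "is_cycle E xs \<longleftrightarrow> length xs \<ge> 3 \<and> distinct xs \<and>
     (\<forall>i. Suc i < length xs \<longrightarrow> (xs ! i, xs ! Suc i) \<in> E) \<and> (last xs, hd xs) \<in> E"

definition undirected_tree :: "('v \<times> 'v) set \<Rightarrow> bool" where
  "undirected_tree E \<longleftrightarrow> sym E \<and> irrefl E \<and> (\<forall>x y. (x, y) \<in> E\<^sup>*) \<and> \<not> (\<exists>xs. is_cycle E xs)"

text \<open>Length of a shortest walk; only meaningful for connected \<open>E\<close>.\<close>

definition gdist :: "('v \<times> 'v) set \<Rightarrow> 'v \<Rightarrow> 'v \<Rightarrow> nat" where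
  "gdist E x y = (LEAST n. (x, y) \<in> E ^^ n)"

definition geodesic_ray :: "('v \<times> 'v) set \<Rightarrow> 'v \<Rightarrow> (nat \<Rightarrow> 'v) \<Rightarrow> bool" where
  "geodesic_ray E orig g \<longleftrightarrow>
     g 0 = orig \<and> (\<forall>i j. int (gdist E (g i) (g j)) = \<bar>int i - int j\<bar>)"

definition ray_proj :: "('v \<times> 'v) set \<Rightarrow> (nat \<Rightarrow> 'v) \<Rightarrow> 'v \<Rightarrow> 'v" where
  "ray_proj E g x = (THE v. v \<in> range g \<and> (\<forall>w \<in> range g. gdist E x v \<le> gdist E x w))"

definition level :: "('v \<times> 'v) set \<Rightarrow> 'v \<Rightarrow> (nat \<Rightarrow> 'v) \<Rightarrow> 'v \<Rightarrow> int" where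
  "level E orig g x =
     int (gdist E orig (ray_proj E g x)) - int (gdist E (ray_proj E g x) x)"

text \<open>\<open>below E orig g x y\<close> is the order relation \<open>x \<le> y\<close> of the rooted tree.\<close>

definition below :: "('v \<times> 'v) set \<Rightarrow> 'v \<Rightarrow> (nat \<Rightarrow> 'v) \<Rightarrow> 'v \<Rightarrow> 'v \<Rightarrow> bool" where
  "below E orig g x y \<longleftrightarrow> level E orig g y - level E orig g x = int (gdist E y x)"

definition sons :: "('v \<times> 'v) set \<Rightarrow> 'v \<Rightarrow> (nat \<Rightarrow> 'v) \<Rightarrow> 'v \<Rightarrow> 'v set" where
  "sons E orig g x = {y. (x, y) \<in> E \<and> level E orig g y = level E orig g x - 1}"

text \<open>
  Local finiteness is not presupposed: \<open>has_sum\<close> also makes sense for an infinite set of sons.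
\<close>

definition flow :: "('v \<times> 'v) set \<Rightarrow> 'v \<Rightarrow> (nat \<Rightarrow> 'v) \<Rightarrow> ('v \<Rightarrow> real) \<Rightarrow> bool" where
  "flow E orig g m \<longleftrightarrow> (\<forall>x. 0 < m x) \<and> (\<forall>x. (m has_sum m x) (sons E orig g x))"

definition weight_measure :: "('v \<Rightarrow> real) \<Rightarrow> 'v measure" where
  "weight_measure m = point_measure UNIV (\<lambda>x. ennreal (m x))"

definition gball :: "('v \<times> 'v) set \<Rightarrow> 'v \<Rightarrow> real \<Rightarrow> 'v set" where
  "gball E x r = {y. real (gdist E x y) \<le> r}"

definition locally_doubling :: "('v \<times> 'v) set \<Rightarrow> ('v \<Rightarrow> real) \<Rightarrow> bool" where
  "locally_doubling E m \<longleftrightarrow>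
     (\<forall>r>0. \<exists>C>1. \<forall>x. emeasure (weight_measure m) (gball E x (2 * r))
                        \<le> ennreal C * emeasure (weight_measure m) (gball E x r))"

definition trapezoid ::
    "('v \<times> 'v) set \<Rightarrow> 'v \<Rightarrow> (nat \<Rightarrow> 'v) \<Rightarrow> nat \<Rightarrow> nat \<Rightarrow> 'v \<Rightarrow> 'v set" where
  "trapezoid E orig g h' h'' x0 =
     {x. below E orig g x x0 \<and> level E orig g x0 - int h'' < level E orig g x
         \<and> level E orig g x \<le> level E orig g x0 - int h'}"

definition admissible ::
    "('v \<times> 'v) set \<Rightarrow> 'v \<Rightarrow> (nat \<Rightarrow> 'v) \<Rightarrow> real \<Rightarrow> 'v set set" where
  "admissible E orig g \<beta> =
     {{x0} |x0. True} \<union>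
     {trapezoid E orig g h' h'' x0 |h' h'' x0.
        1 \<le> h' \<and> h' < h'' \<and> 2 \<le> real h'' / real h' \<and> real h'' / real h' \<le> \<beta>}"

definition maximal_function ::
    "('v \<times> 'v) set \<Rightarrow> 'v \<Rightarrow> (nat \<Rightarrow> 'v) \<Rightarrow> ('v \<Rightarrow> real) \<Rightarrow> real \<Rightarrow>
     ('v \<Rightarrow> complex) \<Rightarrow> 'v \<Rightarrow> ennreal" where
  "maximal_function E orig g m \<beta> f x =
     (SUP R \<in> {R \<in> admissible E orig g \<beta>. x \<in> R}.
        (\<integral>\<^sup>+y\<in>R. ennreal (norm (f y)) \<partial>weight_measure m) / emeasure (weight_measure m) R)"

definition Lp_space :: "real \<Rightarrow> 'a measure \<Rightarrow> ('a \<Rightarrow> 'b::real_normed_vector) set" where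
  "Lp_space p M = {f \<in> borel_measurable M. integrable M (\<lambda>x. norm (f x) powr p)}"

definition Lp_norm :: "real \<Rightarrow> 'a measure \<Rightarrow> ('a \<Rightarrow> 'b::real_normed_vector) \<Rightarrow> real" where
  "Lp_norm p M f = (integral\<^sup>L M (\<lambda>x. norm (f x) powr p)) powr (1 / p)"

end

theory Submission
  imports Defs
begin

text \<open>
  By acyclicity every vertex has only one neighbour closer to a given root, so that the level is
  the Busemann function of the ray and predecessors are unique. Hence, by the flow condition, the
  descendants of \<open>x\<close> at any fixed depth have total mass \<open>m x\<close>, and the mass of a trapezoid is its
  number of layers times the mass of its root. If two members of the family meet, their roots are
  comparable, and the one with the lower root lies in an envelope of the other, of mass at most
  \<open>2 * \<beta>\<close> times as large. Selecting trapezoids in order of decreasing root level therefore gives the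
  weak type bound on finite sets, which suffices for a weighted counting measure. The strong type
  bound follows by truncating \<open>f\<close> at height \<open>t / 2\<close> and integrating over \<open>t\<close>.
\<close>

section \<open>Distances in a tree\<close>

locale undirected_tree_graph =
  fixes E :: "('v \<times> 'v) set"
  assumes tree: "undirected_tree E"
begin

section \<open>Elementary properties of the graph metric\<close>

abbreviation "d \<equiv> gdist E"

lemma edge_sym: "(x, y) \<in> E \<Longrightarrow> (y, x) \<in> E"
  using tree by (auto simp: undirected_tree_def dest: symD)

lemma no_cycle: "\<not> is_cycle E xs"
  using tree by (auto simp: undirected_tree_def)

lemma walk_gdist: "(x, y) \<in> E ^^ d x y"
proof -
  have "(x, y) \<in> E\<^sup>*"
    using tree by (simp add: undirected_tree_def)
  then show ?thesis
    unfolding gdist_def rtrancl_power by (rule LeastI_ex)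
qed

lemma gdist_le: "(x, y) \<in> E ^^ n \<Longrightarrow> d x y \<le> n"
  unfolding gdist_def by (rule Least_le)

lemma gdist_self [simp]: "d x x = 0"
  using gdist_le[of x x 0] by simp

lemma gdist_eq_0_iff [simp]: "d x y = 0 \<longleftrightarrow> x = y"
proof
  assume "d x y = 0"
  with walk_gdist[of x y] show "x = y" by simp
qed simp

lemma gdist_triangle: "d x z \<le> d x y + d y z"
proof (rule gdist_le)
  show "(x, z) \<in> E ^^ (d x y + d y z)"
    unfolding relpow_add using walk_gdist[of x y] walk_gdist[of y z] by (rule relcompI)
qed

lemma gdist_edge_le: "(y, z) \<in> E \<Longrightarrow> d x z \<le> d x y + 1"
  using gdist_le[of x z "Suc (d x y)"] walk_gdist[of x y] by auto

lemma walk_sym: "(x, y) \<in> E ^^ n \<Longrightarrow> (y, x) \<in> E ^^ n"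
proof (induction n arbitrary: y)
  case (Suc n)
  then obtain z where "(x, z) \<in> E ^^ n" "(z, y) \<in> E" by auto
  with Suc.IH[of z] edge_sym show ?case by (blast intro: relpow_Suc_I2)
qed auto

lemma gdist_commute: "d x y = d y x"
  using gdist_le walk_gdist walk_sym by (metis order_antisym)

lemma gdist_Suc_parent:
  assumes "d x y = Suc n"
  obtains z where "(z, y) \<in> E" "d x z = n"
proof -
  from walk_gdist[of x y] assms obtain z where z: "(x, z) \<in> E ^^ n" "(z, y) \<in> E"
    by auto
  have "d x z = n"
    using gdist_le[OF z(1)] gdist_edge_le[OF z(2), of x] assms by simp
  with z(2) show thesis by (rule that)
qed

section \<open>Consequences of acyclicity\<close>

text \<open>
  Such a path would close up to a cycle through an edge between equidistant vertices, or through a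
  vertex with two neighbours closer to \<open>r\<close>.
\<close>

lemma equidistant_path:
  assumes "d r x = n" "d r y = n"
  shows "\<exists>xs. xs \<noteq> [] \<and> distinct xs \<and> hd xs = x \<and> last xs = y \<and>
           (\<forall>i. Suc i < length xs \<longrightarrow> (xs ! i, xs ! Suc i) \<in> E) \<and>
           (\<forall>z \<in> set xs. d r z \<le> n) \<and> (x \<noteq> y \<longrightarrow> length xs \<ge> 3)"
  using assms
proof (induction n arbitrary: x y)
  case 0
  then show ?case by (intro exI[of _ "[x]"]) auto
next
  case (Suc n)
  show ?case
  proof (cases "x = y")
    case True
    with Suc.prems show ?thesis by (intro exI[of _ "[x]"]) auto
  next
    case False
    obtain x' where x': "(x', x) \<in> E" "d r x' = n"
      using Suc.prems(1) by (rule gdist_Suc_parent)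
    obtain y' where y': "(y', y) \<in> E" "d r y' = n"
      using Suc.prems(2) by (rule gdist_Suc_parent)
    obtain xs where xs: "xs \<noteq> []" "distinct xs" "hd xs = x'" "last xs = y'"
      "\<And>i. Suc i < length xs \<Longrightarrow> (xs ! i, xs ! Suc i) \<in> E" "\<And>z. z \<in> set xs \<Longrightarrow> d r z \<le> n"
      using Suc.IH[OF x'(2) y'(2)] by blast
    \<comment> \<open>The path between the parents stays within distance \<open>n\<close> of
      \<open>r\<close>, so it misses \<open>x\<close> and \<open>y\<close>, which lie at distance
      \<open>Suc n\<close>. It is non-empty even if \<open>x' = y'\<close>, whence at least three
      vertices.\<close>
    let ?ys = "x # xs @ [y]"
    have "(?ys ! i, ?ys ! Suc i) \<in> E" if i: "Suc i < length ?ys" for i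
    proof -
      consider "i = 0" | j where "i = Suc j" "Suc j < length xs" | "i = length xs"
        using i by (cases i) (auto simp: less_Suc_eq)
      then show ?thesis
      proof cases
        case 1
        then show ?thesis using xs(1,3) x'(1) edge_sym by (auto simp: nth_append hd_conv_nth)
      next
        case 2
        then show ?thesis using xs(5)[of j] by (auto simp: nth_append)
      next
        case 3
        then obtain k where "i = Suc k" "length xs = Suc k"
          using xs(1) by (cases xs) auto
        then show ?thesis using xs(1,4) y'(1) by (auto simp: nth_append last_conv_nth)
      qed
    qed
    moreover have "x \<notin> set xs" "y \<notin> set xs"
      using xs(6) Suc.prems by fastforce+
    moreover have "d r z \<le> Suc n" if "z \<in> set ?ys" for z
      using that xs(6) Suc.prems by (auto intro: le_SucI)
    moreover have "distinct ?ys" "length ?ys \<ge> 3"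
      using xs(1,2) False \<open>x \<notin> set xs\<close> \<open>y \<notin> set xs\<close> by (auto simp: Suc_le_eq)
    ultimately show ?thesis
      by (intro exI[of _ ?ys]) simp_all
  qed
qed

text \<open>A tree is bipartite: an edge between equidistant vertices would close the path of
  \<open>equidistant_path\<close> to a cycle.\<close>

lemma gdist_edge_neq:
  assumes "(x, y) \<in> E"
  shows "d r x \<noteq> d r y"
proof
  assume eq: "d r x = d r y"
  have "x \<noteq> y"
    using assms tree by (auto simp: undirected_tree_def irrefl_def)
  then obtain xs where xs: "distinct xs" "hd xs = x" "last xs = y" "length xs \<ge> 3"
    "\<And>i. Suc i < length xs \<Longrightarrow> (xs ! i, xs ! Suc i) \<in> E"
    using equidistant_path[OF eq refl] by blast
  then have "is_cycle E xs"
    using edge_sym[OF assms] by (simp add: is_cycle_def)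
  then show False using no_cycle by blast
qed

text \<open>Two such neighbours would be equidistant from \<open>r\<close>. The path joining them
  stays no farther out than they are, so it avoids \<open>z\<close>, and passing through
  \<open>z\<close> closes a cycle.\<close>

lemma closer_neighbour_unique:
  assumes "(x, z) \<in> E" "(y, z) \<in> E" "d r x < d r z" "d r y < d r z"
  shows "x = y"
proof (rule ccontr)
  assume "x \<noteq> y"
  have eq: "d r x = d r y"
    using gdist_edge_le[OF assms(1), of r] gdist_edge_le[OF assms(2), of r] assms(3,4) by simp
  obtain xs where xs: "distinct xs" "hd xs = x" "last xs = y" "length xs \<ge> 3"
    "\<And>i. Suc i < length xs \<Longrightarrow> (xs ! i, xs ! Suc i) \<in> E" "\<And>v. v \<in> set xs \<Longrightarrow> d r v \<le> d r y"
    using equidistant_path[OF eq refl] \<open>x \<noteq> y\<close> by blast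
  have ne: "xs \<noteq> []" using xs(4) by auto
  have "z \<notin> set xs" using xs(6) assms(4) by fastforce
  moreover have "((z # xs) ! i, (z # xs) ! Suc i) \<in> E" if "Suc i < length (z # xs)" for i
    using that xs(2,5) ne edge_sym[OF assms(1)] by (cases i) (auto simp: hd_conv_nth)
  ultimately have "is_cycle E (z # xs)"
    using xs(1,3,4) ne assms(2) by (simp add: is_cycle_def)
  then show False using no_cycle by blast
qed

end

section \<open>The level function\<close>

locale rooted_tree = undirected_tree_graph E
  for E :: "('v \<times> 'v) set" +
  fixes orig :: 'v and g :: "nat \<Rightarrow> 'v"
  assumes ray: "geodesic_ray E orig g"
begin

abbreviation "lev \<equiv> level E orig g"

lemma ray_gdist: "int (d (g i) (g j)) = \<bar>int i - int j\<bar>"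
  using ray by (simp add: geodesic_ray_def)

lemma ray_gdist_origin: "d orig (g n) = n"
  using ray_gdist[of 0 n] ray by (simp add: geodesic_ray_def)

lemma ray_edge: "(g n, g (Suc n)) \<in> E"
proof -
  have "d (g n) (g (Suc n)) = 1" using ray_gdist[of n "Suc n"] by simp
  then show ?thesis using walk_gdist[of "g n" "g (Suc n)"] by simp
qed

lemma ray_inj: "g i = g j \<longleftrightarrow> i = j"
  using ray_gdist[of i j] by (auto simp flip: gdist_eq_0_iff)

text \<open>
  Seen from a vertex \<open>x\<close>, the distance to the ray has no interior local maximum, because the two
  neighbours on the ray would both be closer to \<open>x\<close>.
\<close>

lemma ray_no_peak:
  assumes "d x (g n) < d x (g (Suc n))"
  shows "d x (g (Suc n)) < d x (g (Suc (Suc n)))"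
proof (rule ccontr)
  assume "\<not> ?thesis"
  then have "d x (g (Suc (Suc n))) < d x (g (Suc n))"
    using gdist_edge_neq[OF ray_edge[of "Suc n"], of x] by simp
  with assms have "g n = g (Suc (Suc n))"
    using closer_neighbour_unique ray_edge edge_sym by blast
  then show False by (simp add: ray_inj)
qed

text \<open>Along the ray the distance to \<open>x\<close> changes by exactly one at each step,
  cannot decrease forever, and by \<open>ray_no_peak\<close> keeps increasing once it has increased.
  It is therefore V-shaped, and \<open>k\<close> is the first index followed by an increase.\<close>

lemma ray_gdist_from_projection:
  "\<exists>k. \<forall>n. int (d x (g n)) = int (d x (g k)) + \<bar>int n - int k\<bar>"
proof -
  let ?inc = "\<lambda>n. d x (g n) < d x (g (Suc n))"
  have step: "d x (g (Suc n)) = d x (g n) + 1 \<or> d x (g n) = d x (g (Suc n)) + 1" for n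
    using gdist_edge_neq[OF ray_edge[of n], of x] gdist_edge_le[OF ray_edge[of n], of x]
      gdist_edge_le[OF edge_sym[OF ray_edge[of n]], of x] by linarith
  have "\<exists>n. ?inc n"
  proof (rule ccontr)
    assume "\<nexists>n. ?inc n"
    then have dec: "d x (g n) = d x (g (Suc n)) + 1" for n
      using step[of n] by (metis less_add_one)
    have "d x (g n) + n = d x (g 0)" for n
    proof (induction n)
      case (Suc n)
      then show ?case using dec[of n] by simp
    qed simp
    \<comment> \<open>So many consecutive descents would exceed the initial distance.\<close>
    from this[of "Suc (d x (g 0))"] show False by simp
  qed
  define k where "k = (LEAST n. ?inc n)"
  have k: "?inc k" unfolding k_def using \<open>\<exists>n. ?inc n\<close> by (rule LeastI_ex)
  have before: "\<not> ?inc n" if "n < k" for n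
    using that unfolding k_def by (rule not_less_Least)
  have after: "?inc (k + n)" for n
    by (induction n) (use k ray_no_peak in auto)
  have up: "d x (g (k + n)) = d x (g k) + n" for n
  proof (induction n)
    case (Suc n)
    then show ?case using after[of n] step[of "k + n"] by auto
  qed simp
  have down: "d x (g (k - n)) = d x (g k) + n" if "n \<le> k" for n
    using that
  proof (induction n)
    case (Suc n)
    then have "\<not> ?inc (k - Suc n)" by (intro before) auto
    with Suc step[of "k - Suc n"] show ?case by (auto simp: Suc_diff_Suc)
  qed simp
  have "int (d x (g n)) = int (d x (g k)) + \<bar>int n - int k\<bar>" for n
  proof (cases "k \<le> n")
    case True
    with up[of "n - k"] show ?thesis by simp
  next
    case False
    with down[of "k - n"] show ?thesis by simp
  qed
  then show ?thesis by blast
qed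

text \<open>The level is, up to sign, the Busemann function of the ray.\<close>

lemma level_eventually: "eventually (\<lambda>n. int (d (g n) x) = int n - lev x) sequentially"
proof -
  obtain k where k: "\<And>n. int (d x (g n)) = int (d x (g k)) + \<bar>int n - int k\<bar>"
    using ray_gdist_from_projection by blast
  \<comment> \<open>The V shape makes \<open>g k\<close> the only nearest point, so the definite
    description is well defined.\<close>
  have "ray_proj E g x = g k"
    unfolding ray_proj_def
  proof (rule the_equality)
    show "g k \<in> range g \<and> (\<forall>w\<in>range g. d x (g k) \<le> d x w)"
    proof (intro conjI ballI)
      fix w assume "w \<in> range g"
      then obtain n where "w = g n" by auto
      with k[of n] show "d x (g k) \<le> d x w" by simp
    qed simp
  next
    fix v assume "v \<in> range g \<and> (\<forall>w\<in>range g. d x v \<le> d x w)"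
    then obtain n where n: "v = g n" "d x (g n) \<le> d x (g k)" by auto
    from n(2) k[of n] have "n = k" by linarith
    with n(1) show "v = g k" by simp
  qed
  then have "lev x = int k - int (d x (g k))"
    by (simp add: level_def ray_gdist_origin gdist_commute[of _ x])
  then have "int (d (g n) x) = int n - lev x" if "n \<ge> k" for n
    using k[of n] that gdist_commute[of "g n" x] by linarith
  then show ?thesis unfolding eventually_sequentially by blast
qed

text \<open>Reading off both levels at one far point of the ray turns the claim into the triangle
  inequality.\<close>

lemma level_diff_le: "lev x - lev y \<le> int (d x y)"
proof -
  have "eventually (\<lambda>n. int (d (g n) x) = int n - lev x \<and> int (d (g n) y) = int n - lev y) sequentially"
    by (intro eventually_conj level_eventually)
  then obtain n where "int (d (g n) x) = int n - lev x" "int (d (g n) y) = int n - lev y"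
    using eventually_happens' sequentially_bot by blast
  then show ?thesis using gdist_triangle[of "g n" y x] by (simp add: gdist_commute[of y])
qed

text \<open>From a far point of the ray, a higher level means a smaller distance, so both candidates
  are neighbours of \<open>z\<close> closer to that point.\<close>

lemma predecessor_unique:
  assumes "z \<in> sons E orig g x" "z \<in> sons E orig g y"
  shows "x = y"
proof -
  have "eventually (\<lambda>n. int (d (g n) x) = int n - lev x \<and> int (d (g n) y) = int n - lev y
          \<and> int (d (g n) z) = int n - lev z) sequentially"
    by (intro eventually_conj level_eventually)
  then obtain n where "int (d (g n) x) = int n - lev x" "int (d (g n) y) = int n - lev y"
      "int (d (g n) z) = int n - lev z"
    using eventually_happens' sequentially_bot by blast
  with assms have "d (g n) x < d (g n) z" "d (g n) y < d (g n) z"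
    by (simp_all add: sons_def)
  with assms show ?thesis
    by (auto simp: sons_def intro: closer_neighbour_unique)
qed

section \<open>Descendants\<close>

definition descendants :: "nat \<Rightarrow> 'v \<Rightarrow> 'v set" where
  "descendants k x = {y. below E orig g y x \<and> lev y = lev x - int k}"

lemma descendants_iff: "y \<in> descendants k x \<longleftrightarrow> d x y = k \<and> lev y = lev x - int k"
  by (auto simp: descendants_def below_def)

lemma descendants_0 [simp]: "descendants 0 x = {x}"
  by (auto simp: descendants_iff)

text \<open>The triangle inequality bounds the distance from above, the level drop bounds it from
  below.\<close>

lemma descendants_trans:
  assumes "y \<in> descendants j x" "z \<in> descendants k y"
  shows "z \<in> descendants (j + k) x"
  using assms gdist_triangle[of x z y] level_diff_le[of x z] by (auto simp: descendants_iff)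

lemma sons_eq_descendants: "sons E orig g x = descendants 1 x"
proof -
  have "(x, y) \<in> E \<longleftrightarrow> d x y = 1" if "lev y = lev x - 1" for y
  proof
    assume "(x, y) \<in> E"
    then have "d x y \<le> 1" using gdist_edge_le[of x y x] by simp
    moreover have "x \<noteq> y" using that by auto
    ultimately show "d x y = 1" by (simp add: le_Suc_eq)
  next
    assume "d x y = 1"
    then show "(x, y) \<in> E" using walk_gdist[of x y] by simp
  qed
  then show ?thesis by (auto simp: sons_def descendants_iff)
qed

text \<open>The vertex before \<open>z\<close> on a geodesic from \<open>x\<close> works: the level
  drops by at most one per unit of distance, so a total drop of \<open>Suc k\<close> leaves no slack
  on either part.\<close>

lemma descendants_SucE:
  assumes "z \<in> descendants (Suc k) x"
  obtains y where "y \<in> descendants k x" "z \<in> sons E orig g y"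
proof -
  have "d x z = Suc k" using assms by (simp add: descendants_iff)
  then obtain y where y: "(y, z) \<in> E" "d x y = k" by (rule gdist_Suc_parent)
  have "lev y - lev z \<le> 1"
    using level_diff_le[of y z] gdist_edge_le[OF y(1), of y] by simp
  moreover have "lev x - lev y \<le> int k" using level_diff_le[of x y] y(2) by simp
  ultimately have "lev y = lev x - int k" "lev z = lev y - 1"
    using assms by (auto simp: descendants_iff)
  with y that show thesis by (auto simp: descendants_iff sons_def)
qed

text \<open>Unique predecessors force the two upward chains from \<open>z\<close> to coincide until
  \<open>y\<close> is reached. This makes the roots of intersecting trapezoids comparable.\<close>

lemma common_descendant:
  assumes "z \<in> descendants k x" "z \<in> descendants j y" "j \<le> k"
  shows "y \<in> descendants (k - j) x"
  using assms
proof (induction j arbitrary: z k)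
  case (Suc j)
  obtain k' where k': "k = Suc k'" using Suc.prems(3) by (cases k) auto
  obtain u where u: "u \<in> descendants k' x" "z \<in> sons E orig g u"
    using Suc.prems(1) unfolding k' by (rule descendants_SucE)
  obtain w where w: "w \<in> descendants j y" "z \<in> sons E orig g w"
    using Suc.prems(2) by (rule descendants_SucE)
  have "u = w" using predecessor_unique u(2) w(2) .
  with Suc.IH[of u k'] u(1) w(1) Suc.prems(3) k' show ?case by simp
qed auto

lemma descendants_Suc: "descendants (Suc k) x = (\<Union>y\<in>sons E orig g x. descendants k y)"
proof
  show "(\<Union>y\<in>sons E orig g x. descendants k y) \<subseteq> descendants (Suc k) x"
  proof
    fix z assume "z \<in> (\<Union>y\<in>sons E orig g x. descendants k y)"
    then obtain y where "y \<in> descendants 1 x" "z \<in> descendants k y"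
      by (auto simp only: sons_eq_descendants)
    then have "z \<in> descendants (1 + k) x" by (rule descendants_trans)
    then show "z \<in> descendants (Suc k) x" by simp
  qed
next
  \<comment> \<open>\<open>descendants_SucE\<close> splits off the last generation, but here the
    first one is wanted; induction on the depth moves the split to the top.\<close>
  show "descendants (Suc k) x \<subseteq> (\<Union>y\<in>sons E orig g x. descendants k y)"
  proof (induction k)
    case 0
    then show ?case by (auto simp: sons_eq_descendants)
  next
    case (Suc k)
    show ?case
    proof
      fix z assume "z \<in> descendants (Suc (Suc k)) x"
      then obtain u where u: "u \<in> descendants (Suc k) x" "z \<in> sons E orig g u"
        by (rule descendants_SucE)
      with Suc obtain y where "y \<in> sons E orig g x" "u \<in> descendants k y" by blast
      moreover from this(2) u(2) have "z \<in> descendants (k + 1) y"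
        unfolding sons_eq_descendants by (rule descendants_trans)
      ultimately show "z \<in> (\<Union>y\<in>sons E orig g x. descendants (Suc k) y)"
        by auto
    qed
  qed
qed

lemma descendants_disjoint: "y \<noteq> y' \<Longrightarrow> descendants k y \<inter> descendants k y' = {}"
  using common_descendant[of _ k y k y'] by auto

lemma descendants_disjoint_depth: "k \<noteq> k' \<Longrightarrow> descendants k x \<inter> descendants k' x = {}"
  by (auto simp: descendants_iff)

end

section \<open>Weighted counting measures\<close>

lemma space_weight_measure [simp]: "space (weight_measure m) = UNIV"
  by (simp add: weight_measure_def space_point_measure)

lemma sets_weight_measure [simp]: "sets (weight_measure m) = UNIV"
  by (simp add: weight_measure_def sets_point_measure)

lemma measurable_weight_measure [simp]: "f \<in> measurable (weight_measure m) N \<longleftrightarrow> f \<in> UNIV \<rightarrow> space N"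
  by (simp add: weight_measure_def)

lemma nn_integral_weight_measure:
  "(\<integral>\<^sup>+x. h x \<partial>weight_measure m) = (\<integral>\<^sup>+x. ennreal (m x) * h x \<partial>count_space UNIV)"
  by (simp add: weight_measure_def point_measure_def nn_integral_density)

lemma emeasure_weight_measure:
  "emeasure (weight_measure m) A = (\<integral>\<^sup>+x. ennreal (m x) \<partial>count_space A)"
  by (simp add: weight_measure_def point_measure_def emeasure_density
      nn_integral_count_space_indicator)

lemma emeasure_weight_measure_finite:
  "finite A \<Longrightarrow> emeasure (weight_measure m) A = (\<Sum>x\<in>A. ennreal (m x))"
  by (simp add: emeasure_weight_measure nn_integral_count_space_finite)

text \<open>Turns the flow condition, which is phrased with \<open>has_sum\<close>, into a statement
  about the measure.\<close>

lemma emeasure_weight_measure_has_sum: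
  assumes "(m has_sum s) A" "\<And>x. x \<in> A \<Longrightarrow> 0 \<le> m x"
  shows "emeasure (weight_measure m) A = ennreal s"
proof -
  have "m summable_on A" using assms(1) by (rule has_sum_imp_summable)
  then have "(\<lambda>x. norm (m x)) summable_on A"
    using summable_on_iff_abs_summable_on_real by blast
  then have "Infinite_Set_Sum.abs_summable_on m A"
    using abs_summable_equivalent by blast
  then show ?thesis
    using assms by (simp add: emeasure_weight_measure nn_integral_conv_infsetsum
        infsetsum_infsum infsumI)
qed

text \<open>A simple function below \<open>f\<close> either has finite support, and its integral is
  a finite sum, or takes a nonzero value infinitely often, and then \<open>b\<close> must be
  infinite. This permits the passage from finite sets to arbitrary ones, countable or not.\<close>

lemma nn_integral_count_space_leI:
  fixes f :: "'a \<Rightarrow> ennreal"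
  assumes "\<And>F. finite F \<Longrightarrow> F \<subseteq> A \<Longrightarrow> sum f F \<le> b"
  shows "(\<integral>\<^sup>+x. f x \<partial>count_space A) \<le> b"
  unfolding nn_integral_def
proof (rule SUP_least)
  fix s assume "s \<in> {s. simple_function (count_space A) s \<and> s \<le> f}"
  then have s: "finite (s ` A)" "s x \<le> f x" for x
    by (auto simp: le_fun_def)
  have sum_s: "sum s F \<le> b" if "finite F" "F \<subseteq> A" for F
    using assms[OF that] s(2) by (meson order_trans sum_mono)
  have simp: "simple_function (count_space A) s" using s(1) by simp
  show "integral\<^sup>S (count_space A) s \<le> b"
  proof (cases "finite {x\<in>A. s x \<noteq> 0}")
    case True
    then have "integral\<^sup>S (count_space A) s = (\<Sum>x | x \<in> A \<and> s x \<noteq> 0. s x)"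
      using simp by (simp add: nn_integral_eq_simple_integral[symmetric] nn_integral_count_space
          zero_less_iff_neq_zero)
    also have "\<dots> \<le> b" using True by (intro sum_s) auto
    finally show ?thesis .
  next
    case False
    have "finite (s ` {x\<in>A. s x \<noteq> 0})" using s(1) by (rule finite_subset[rotated]) auto
    then obtain y where y: "y \<in> s ` {x\<in>A. s x \<noteq> 0}"
      "infinite (s -` {y} \<inter> {x\<in>A. s x \<noteq> 0})"
      using False by (rule inf_img_fin_domE')
    \<comment> \<open>Any \<open>n\<close> points of the infinite fibre over \<open>y\<close>
      contribute \<open>n\<close> times \<open>y\<close>, and \<open>y\<close> is nonzero.\<close>
    have "of_nat n * y \<le> b" for n :: nat
    proof -
      obtain F where F: "finite F" "card F = n" "F \<subseteq> s -` {y} \<inter> {x\<in>A. s x \<noteq> 0}"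
        using infinite_arbitrarily_large[OF y(2)] by blast
      then have "sum s F = of_nat n * y"
        by (subst sum.cong[where B = F and h = "\<lambda>_. y"]) auto
      with sum_s[of F] F show ?thesis by auto
    qed
    then have "(SUP n. of_nat n * y) \<le> b" by (rule SUP_least)
    moreover have "(SUP n. of_nat n * y) = top"
      using y(1) by (auto simp: SUP_mult_right_ennreal[symmetric] ennreal_SUP_of_nat_eq_top ennreal_top_mult)
    ultimately show ?thesis by (simp add: top_unique)
  qed
qed

lemma emeasure_weight_measure_leI:
  assumes "\<And>F. finite F \<Longrightarrow> F \<subseteq> A \<Longrightarrow> emeasure (weight_measure m) F \<le> b"
  shows "emeasure (weight_measure m) A \<le> b"
  unfolding emeasure_weight_measure
  by (rule nn_integral_count_space_leI)
    (use assms in \<open>simp add: emeasure_weight_measure_finite\<close>)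

text \<open>Greedy selection as in the Vitali covering lemma: pick an index of maximal rank, discard
  all sets meeting the chosen one, which its envelope covers, and recurse on the rest.\<close>

lemma disjoint_subfamily:
  fixes rank :: "'i \<Rightarrow> 'b :: linorder"
  assumes "finite I"
    and "\<And>i j. i \<in> I \<Longrightarrow> j \<in> I \<Longrightarrow> rank j \<le> rank i \<Longrightarrow> X i \<inter> X j \<noteq> {} \<Longrightarrow> X j \<subseteq> env i"
  shows "\<exists>J \<subseteq> I. disjoint_family_on X J \<and> \<Union>(X ` I) \<subseteq> \<Union>(env ` J)"
  using assms
proof (induction I rule: finite_psubset_induct)
  case (psubset I)
  show ?case
  proof (cases "I = {}")
    case False
    have "Max (rank ` I) \<in> rank ` I" using psubset.hyps False by (intro Max_in) auto
    then obtain i where i: "i \<in> I" "rank i = Max (rank ` I)" by auto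
    then have max: "rank j \<le> rank i" if "j \<in> I" for j
      using that psubset.hyps by simp
    \<comment> \<open>The condition \<open>j \<noteq> i\<close> matters when \<open>X i\<close> is
      empty: it makes \<open>I'\<close> a proper subset even then.\<close>
    define I' where "I' = {j \<in> I. j \<noteq> i \<and> X i \<inter> X j = {}}"
    have "I' \<subset> I" using i(1) by (auto simp: I'_def)
    moreover have "X k \<subseteq> env j" if "j \<in> I'" "k \<in> I'" "rank k \<le> rank j" "X j \<inter> X k \<noteq> {}" for j k
      using that psubset.prems by (auto simp: I'_def)
    ultimately obtain J where J: "J \<subseteq> I'" "disjoint_family_on X J" "\<Union>(X ` I') \<subseteq> \<Union>(env ` J)"
      using psubset.IH by meson
    have "disjoint_family_on X (insert i J)"
      using J(1,2) by (auto simp: disjoint_family_on_def I'_def)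
    moreover have "X j \<subseteq> \<Union>(env ` insert i J)" if "j \<in> I" for j
    proof (cases "j \<in> I'")
      case True
      with J(3) show ?thesis by blast
    next
      case False
      then have "X j = {} \<or> X i \<inter> X j \<noteq> {}" using that by (auto simp: I'_def)
      then have "X j \<subseteq> env i" using psubset.prems[OF i(1) that max[OF that]] by auto
      then show ?thesis by auto
    qed
    ultimately show ?thesis
      using J(1) i(1) \<open>I' \<subset> I\<close> by (intro exI[of _ "insert i J"]) blast
  qed (auto simp: disjoint_family_on_def)
qed

section \<open>The weak type inequality\<close>

locale flow_tree = rooted_tree E orig g
  for E :: "('v \<times> 'v) set" and orig :: 'v and g :: "nat \<Rightarrow> 'v" +
  fixes m :: "'v \<Rightarrow> real"
  assumes is_flow: "flow E orig g m"
begin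

abbreviation "\<mu> \<equiv> weight_measure m"

lemma m_pos: "0 < m x"
  using is_flow by (simp add: flow_def)

lemma m_has_sum_sons: "(m has_sum m x) (sons E orig g x)"
  using is_flow by (simp add: flow_def)

lemma emeasure_sons: "emeasure \<mu> (sons E orig g x) = ennreal (m x)"
  using m_has_sum_sons m_pos by (intro emeasure_weight_measure_has_sum) (auto intro: less_imp_le)

text \<open>A summable family has countable support, and by positivity the support consists of all
  sons. This is what allows countable additivity over the sons.\<close>

lemma countable_sons: "countable (sons E orig g x)"
proof -
  have "countable {y \<in> sons E orig g x. m y \<noteq> 0}"
    using m_has_sum_sons[THEN has_sum_imp_summable] by (rule summable_countable_real)
  then show ?thesis using m_pos by (simp add: less_imp_neq[symmetric])
qed

text \<open>Split by the first generation: by induction the part below each son has the mass of that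
  son, and the flow condition adds these masses up.\<close>

lemma emeasure_descendants: "emeasure \<mu> (descendants k x) = ennreal (m x)"
proof (induction k arbitrary: x)
  case 0
  then show ?case by (simp add: emeasure_weight_measure_finite)
next
  case (Suc k)
  have "emeasure \<mu> (descendants (Suc k) x)
      = (\<integral>\<^sup>+y. emeasure \<mu> (descendants k y) \<partial>count_space (sons E orig g x))"
    unfolding descendants_Suc using countable_sons descendants_disjoint
    by (intro emeasure_UN_countable) (auto simp: disjoint_family_on_def)
  then show ?case
    by (simp add: Suc emeasure_sons flip: emeasure_weight_measure)
qed

text \<open>Arbitrary sets of depths give singletons, trapezoids and envelopes a common
  form.\<close>

definition slab :: "nat set \<Rightarrow> 'v \<Rightarrow> 'v set" where
  "slab K x = (\<Union>k\<in>K. descendants k x)"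

lemma emeasure_slab: "finite K \<Longrightarrow> emeasure \<mu> (slab K x) = ennreal (real (card K) * m x)"
proof -
  assume K: "finite K"
  have "emeasure \<mu> (slab K x) = (\<Sum>k\<in>K. emeasure \<mu> (descendants k x))"
    unfolding slab_def using K descendants_disjoint_depth
    by (intro sum_emeasure[symmetric]) (auto simp: disjoint_family_on_def)
  also have "\<dots> = ennreal (real (card K) * m x)"
    using m_pos[of x] by (simp add: emeasure_descendants ennreal_mult ennreal_of_nat_eq_real_of_nat)
  finally show ?thesis .
qed

lemma trapezoid_eq_slab: "trapezoid E orig g h' h'' x = slab {h'..<h''} x"
proof (rule set_eqI)
  fix y
  show "y \<in> trapezoid E orig g h' h'' x \<longleftrightarrow> y \<in> slab {h'..<h''} x"
    by (auto simp: trapezoid_def slab_def descendants_iff below_def)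
qed

section \<open>Trapezoids and their envelopes\<close>

text \<open>A singleton is encoded as the slab between the depths 0 and 1.\<close>

definition valid :: "real \<Rightarrow> nat \<Rightarrow> nat \<Rightarrow> bool" where
  "valid \<beta> h' h'' \<longleftrightarrow> h' = 0 \<and> h'' = 1 \<or> 1 \<le> h' \<and> 2 * h' \<le> h'' \<and> real h'' \<le> \<beta> * real h'"

lemma admissibleE:
  assumes "R \<in> admissible E orig g \<beta>"
  obtains x h' h'' where "R = slab {h'..<h''} x" "valid \<beta> h' h''"
  using assms unfolding admissible_def
proof
  assume "R \<in> {{x0} |x0. True}"
  then obtain x where "R = {x}" by auto
  then show thesis by (intro that[of 0 1 x]) (auto simp: slab_def valid_def)
next
  assume "R \<in> {trapezoid E orig g h' h'' x0 |h' h'' x0.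
    1 \<le> h' \<and> h' < h'' \<and> 2 \<le> real h'' / real h' \<and> real h'' / real h' \<le> \<beta>}"
  then obtain x h' h'' where R: "R = trapezoid E orig g h' h'' x" "1 \<le> h'"
    "2 \<le> real h'' / real h'" "real h'' / real h' \<le> \<beta>" by blast
  then have "2 * real h' \<le> real h''" "real h'' \<le> \<beta> * real h'"
    by (auto simp: field_simps)
  then show thesis using R(1,2) by (intro that[of h' h'' x]) (auto simp: trapezoid_eq_slab valid_def)
qed

text \<open>
  The envelope of a genuine trapezoid starts at depth 1: including the root could push the number
  of layers above \<open>\<beta> * real h''\<close> and spoil the constant \<open>2 * \<beta>\<close>.
\<close>

definition envelope :: "real \<Rightarrow> nat \<Rightarrow> nat \<Rightarrow> 'v \<Rightarrow> 'v set" where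
  "envelope \<beta> h' h'' = slab {k. real k < \<beta> * real h'' \<and> (k = 0 \<longleftrightarrow> h' = 0)}"

lemma envelope_singleton: "\<beta> \<ge> 1 \<Longrightarrow> envelope \<beta> 0 (Suc 0) x = {x}"
  by (auto simp: envelope_def slab_def)

lemma emeasure_slab_pos:
  assumes "valid \<beta> h' h''"
  shows "0 < emeasure \<mu> (slab {h'..<h''} x)" "emeasure \<mu> (slab {h'..<h''} x) < \<infinity>"
  using assms m_pos[of x] by (auto simp: valid_def emeasure_slab)

text \<open>All layers below \<open>x\<close> weigh the same. The envelope has at most
  \<open>\<beta> * real h''\<close> of them, while \<open>2 * h' \<le> h''\<close> leaves at least
  half of \<open>h''\<close> to the trapezoid. A singleton is its own envelope.\<close>

lemma emeasure_envelope_le: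
  assumes "valid \<beta> h' h''" "\<beta> \<ge> 1"
  shows "emeasure \<mu> (envelope \<beta> h' h'' x) \<le> ennreal (2 * \<beta>) * emeasure \<mu> (slab {h'..<h''} x)"
proof (cases "h' = 0")
  case True
  then have h: "h'' = Suc 0" using assms(1) by (auto simp: valid_def)
  have "ennreal (m x) \<le> ennreal (2 * \<beta> * m x)"
    using assms(2) m_pos[of x] by (intro ennreal_leI) simp
  then show ?thesis
    using True h assms(2) m_pos[of x]
    by (simp add: envelope_singleton emeasure_slab emeasure_weight_measure_finite ennreal_mult)
next
  case False
  let ?K = "{k. real k < \<beta> * real h'' \<and> (k = 0 \<longleftrightarrow> h' = 0)}"
  \<comment> \<open>As depth 0 is excluded, the number of layers is at most the floor, without an
    extra one.\<close>
  have sub: "?K \<subseteq> {1..nat \<lfloor>\<beta> * real h''\<rfloor>}"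
    using False by (auto simp: le_nat_floor Suc_le_eq)
  then have fin: "finite ?K" by (rule finite_subset) simp
  have "card ?K \<le> nat \<lfloor>\<beta> * real h''\<rfloor>" using card_mono[OF _ sub] by simp
  then have "real (card ?K) \<le> \<beta> * real h''"
    using assms(2) by (simp add: le_nat_iff le_floor_iff)
  also have "\<dots> \<le> \<beta> * (2 * real (h'' - h'))"
    using assms False by (intro mult_left_mono) (auto simp: valid_def of_nat_diff)
  finally have "real (card ?K) * m x \<le> 2 * \<beta> * (real (h'' - h') * m x)"
    using m_pos[of x] by simp
  then show ?thesis
    using fin assms(2) m_pos[of x]
    by (simp add: envelope_def emeasure_slab ennreal_leI flip: ennreal_mult)
qed

text \<open>Let \<open>z\<close> be a common point, at depth \<open>k\<close> below \<open>x\<close>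
  and \<open>l\<close> below \<open>y\<close>. A point at depth \<open>n\<close> below
  \<open>y\<close> has depth \<open>k - l + n\<close> below \<open>x\<close>. For a genuine
  trapezoid at \<open>y\<close>, \<open>n < b' \<le> \<beta> * a' \<le> \<beta> * l\<close>, so this
  depth is less than \<open>\<beta> * k\<close>.\<close>

lemma slab_subset_envelope:
  assumes i: "valid \<beta> a b" and j: "valid \<beta> a' b'" and \<beta>: "\<beta> \<ge> 1"
    and lev: "lev y \<le> lev x"
    and meet: "slab {a..<b} x \<inter> slab {a'..<b'} y \<noteq> {}"
  shows "slab {a'..<b'} y \<subseteq> envelope \<beta> a b x"
proof -
  obtain z k l where z: "z \<in> descendants k x" "a \<le> k" "k < b"
      "z \<in> descendants l y" "a' \<le> l" "l < b'"
    using meet by (auto simp: slab_def)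
  \<comment> \<open>The point \<open>z\<close> lies at most as deep below the lower root as below
    the higher one.\<close>
  have "l \<le> k" using z(1,4) lev by (auto simp: descendants_iff)
  with z have y: "y \<in> descendants (k - l) x" by (intro common_descendant)
  show ?thesis
  proof
    fix w assume "w \<in> slab {a'..<b'} y"
    then obtain n where n: "w \<in> descendants n y" "a' \<le> n" "n < b'" by (auto simp: slab_def)
    have w: "w \<in> descendants (k - l + n) x" using y n(1) by (rule descendants_trans)
    have "real (k - l + n) < \<beta> * real b"
    proof (cases "a' = 0")
      case True
      then have "n = 0" "l = 0" using j n z by (auto simp: valid_def)
      have "real k < real b" using z by simp
      also have "\<dots> \<le> \<beta> * real b" using \<beta> mult_right_mono[of 1 \<beta> "real b"] by simp
      finally show ?thesis using \<open>n = 0\<close> \<open>l = 0\<close> by simp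
    next
      case False
      then have "real b' \<le> \<beta> * real a'" using j by (auto simp: valid_def)
      also have "\<dots> \<le> \<beta> * real l" using \<beta> z by (intro mult_left_mono) auto
      finally have "real (k - l + n) < real k - real l + \<beta> * real l"
        using n \<open>l \<le> k\<close> by (simp add: of_nat_diff)
      also have "real k - real l \<le> \<beta> * (real k - real l)"
        using \<beta> \<open>l \<le> k\<close> mult_right_mono[of 1 \<beta> "real k - real l"] by simp
      then have "real k - real l + \<beta> * real l \<le> \<beta> * real k" by (simp add: algebra_simps)
      also have "\<dots> \<le> \<beta> * real b" using \<beta> z by (intro mult_left_mono) auto
      finally show ?thesis .
    qed
    \<comment> \<open>Depth 0 arises only among singletons: a zero sum gives \<open>n = 0\<close>,
      hence \<open>a' = 0\<close>, \<open>l = 0\<close> and \<open>k = 0\<close>; conversely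
      \<open>a = 0\<close> gives \<open>k = 0\<close>, then \<open>l = 0\<close>,
      \<open>a' = 0\<close> and \<open>n = 0\<close>.\<close>
    moreover have "k - l + n = 0 \<longleftrightarrow> a = 0"
      using i j z n \<open>l \<le> k\<close> by (auto simp: valid_def)
    ultimately have "k - l + n \<in> {k. real k < \<beta> * real b \<and> (k = 0 \<longleftrightarrow> a = 0)}" by simp
    then show "w \<in> envelope \<beta> a b x" using w unfolding envelope_def slab_def by (rule UN_I)
  qed
qed

text \<open>Every point of \<open>F\<close> lies in a set with large average. The envelopes of a
  disjoint selection cover \<open>F\<close> at the cost of a factor \<open>2 * \<beta>\<close>, and
  by disjointness the integrals over the selected sets add up to at most the full integral.\<close>

lemma weak_type_finite:
  fixes u :: "'v \<Rightarrow> ennreal"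
  assumes \<beta>: "\<beta> \<ge> 1" and F: "finite F"
    and large: "\<And>x. x \<in> F \<Longrightarrow> \<exists>R \<in> admissible E orig g \<beta>. x \<in> R \<and>
                  ennreal t * emeasure \<mu> R \<le> (\<integral>\<^sup>+y\<in>R. u y \<partial>\<mu>)"
  shows "ennreal t * emeasure \<mu> F \<le> ennreal (2 * \<beta>) * (\<integral>\<^sup>+y. u y \<partial>\<mu>)"
proof -
  \<comment> \<open>An index is a triple: the root, the first depth, and the first depth no longer
    included.\<close>
  define X where "X i = slab {fst (snd i)..<snd (snd i)} (fst i)" for i
  define env where "env i = envelope \<beta> (fst (snd i)) (snd (snd i)) (fst i)" for i
  have "\<exists>i. x \<in> X i \<and> valid \<beta> (fst (snd i)) (snd (snd i)) \<and>
          ennreal t * emeasure \<mu> (X i) \<le> (\<integral>\<^sup>+y\<in>X i. u y \<partial>\<mu>)" if x: "x \<in> F" for x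
  proof -
    obtain R where R: "R \<in> admissible E orig g \<beta>" "x \<in> R"
      "ennreal t * emeasure \<mu> R \<le> (\<integral>\<^sup>+y\<in>R. u y \<partial>\<mu>)"
      using large[OF x] by blast
    from R(1) obtain x0 h' h'' where "R = slab {h'..<h''} x0" "valid \<beta> h' h''"
      by (rule admissibleE)
    with R(2,3) show ?thesis by (intro exI[of _ "(x0, h', h'')"]) (simp add: X_def)
  qed
  then obtain idx where idx: "\<And>x. x \<in> F \<Longrightarrow> x \<in> X (idx x)"
    "\<And>x. x \<in> F \<Longrightarrow> valid \<beta> (fst (snd (idx x))) (snd (snd (idx x)))"
    "\<And>x. x \<in> F \<Longrightarrow> ennreal t * emeasure \<mu> (X (idx x)) \<le> (\<integral>\<^sup>+y\<in>X (idx x). u y \<partial>\<mu>)"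
    by metis
  let ?I = "idx ` F"
  have I: "valid \<beta> (fst (snd i)) (snd (snd i))" "ennreal t * emeasure \<mu> (X i) \<le> (\<integral>\<^sup>+y\<in>X i. u y \<partial>\<mu>)"
    if "i \<in> ?I" for i
    using that idx by auto
  \<comment> \<open>The rank is the level of the root, matching the level hypothesis of
    \<open>slab_subset_envelope\<close>.\<close>
  have "\<exists>J \<subseteq> ?I. disjoint_family_on X J \<and> \<Union>(X ` ?I) \<subseteq> \<Union>(env ` J)"
    unfolding X_def env_def using F I(1) \<beta>
    by (intro disjoint_subfamily[where rank = "\<lambda>i. lev (fst i)"] slab_subset_envelope) auto
  then obtain J where J: "J \<subseteq> ?I" "disjoint_family_on X J" "\<Union>(X ` ?I) \<subseteq> \<Union>(env ` J)" by blast
  have fin: "finite J" using finite_subset[OF J(1)] F by simp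
  have "F \<subseteq> \<Union>(X ` ?I)" using idx(1) by auto
  then have "emeasure \<mu> F \<le> emeasure \<mu> (\<Union>(env ` J))"
    using J(3) by (intro emeasure_mono) auto
  also have "\<dots> \<le> (\<Sum>i\<in>J. emeasure \<mu> (env i))"
    using fin by (intro emeasure_subadditive_finite) auto
  also have "\<dots> \<le> (\<Sum>i\<in>J. ennreal (2 * \<beta>) * emeasure \<mu> (X i))"
    unfolding X_def env_def using \<beta> J(1) by (intro sum_mono emeasure_envelope_le I(1)) blast+
  finally have "ennreal t * emeasure \<mu> F \<le> ennreal t * (\<Sum>i\<in>J. ennreal (2 * \<beta>) * emeasure \<mu> (X i))"
    by (rule mult_left_mono) simp
  also have "\<dots> = ennreal (2 * \<beta>) * (\<Sum>i\<in>J. ennreal t * emeasure \<mu> (X i))"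
    by (simp add: sum_distrib_left mult_ac)
  also have "\<dots> \<le> ennreal (2 * \<beta>) * (\<Sum>i\<in>J. \<integral>\<^sup>+y\<in>X i. u y \<partial>\<mu>)"
    using J(1) by (intro mult_left_mono sum_mono I(2)) auto
  also have "(\<Sum>i\<in>J. \<integral>\<^sup>+y\<in>X i. u y \<partial>\<mu>) = (\<integral>\<^sup>+y. (\<Sum>i\<in>J. u y * indicator (X i) y) \<partial>\<mu>)"
    by (rule nn_integral_sum[symmetric]) simp
  also have "\<dots> = (\<integral>\<^sup>+y. u y * indicator (\<Union>(X ` J)) y \<partial>\<mu>)"
    using fin J(2) by (simp add: indicator_UN_disjoint sum_distrib_left)
  also have "\<dots> \<le> (\<integral>\<^sup>+y. u y \<partial>\<mu>)"
    by (intro nn_integral_mono) (auto split: split_indicator)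
  finally show ?thesis by (simp add: mult_left_mono)
qed

text \<open>Taking an extended nonnegative function as argument allows truncations of the modulus of
  \<open>f\<close> to be inserted directly.\<close>

definition avg_sup :: "real \<Rightarrow> ('v \<Rightarrow> ennreal) \<Rightarrow> 'v \<Rightarrow> ennreal" where
  "avg_sup \<beta> u x = (SUP R \<in> {R \<in> admissible E orig g \<beta>. x \<in> R}.
      (\<integral>\<^sup>+y\<in>R. u y \<partial>\<mu>) / emeasure \<mu> R)"

lemma maximal_function_eq_avg_sup:
  "maximal_function E orig g m \<beta> f = avg_sup \<beta> (\<lambda>y. ennreal (norm (f y)))"
  by (simp add: maximal_function_def avg_sup_def fun_eq_iff)

lemma weak_type:
  assumes "\<beta> \<ge> 1"
  shows "ennreal t * emeasure \<mu> {x. avg_sup \<beta> u x > ennreal t} \<le> ennreal (2 * \<beta>) * (\<integral>\<^sup>+y. u y \<partial>\<mu>)"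
proof (cases "t > 0")
  case True
  have fin: "ennreal t * emeasure \<mu> F \<le> ennreal (2 * \<beta>) * (\<integral>\<^sup>+y. u y \<partial>\<mu>)"
    if F: "finite F" "F \<subseteq> {x. avg_sup \<beta> u x > ennreal t}" for F
  proof (rule weak_type_finite[OF assms F(1)])
    fix x assume "x \<in> F"
    with F(2) obtain R where R: "R \<in> admissible E orig g \<beta>" "x \<in> R"
      "ennreal t < (\<integral>\<^sup>+y\<in>R. u y \<partial>\<mu>) / emeasure \<mu> R"
      unfolding avg_sup_def by (auto simp: less_SUP_iff)
    have "0 < emeasure \<mu> R" "emeasure \<mu> R < \<infinity>"
      using R(1) emeasure_slab_pos by (metis admissibleE)+
    then have "(\<integral>\<^sup>+y\<in>R. u y \<partial>\<mu>) / emeasure \<mu> R * emeasure \<mu> R = (\<integral>\<^sup>+y\<in>R. u y \<partial>\<mu>)"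
      by (subst mult.commute, subst ennreal_times_divide, subst mult.commute)
        (auto intro: mult_divide_eq_ennreal)
    moreover have "ennreal t * emeasure \<mu> R \<le> (\<integral>\<^sup>+y\<in>R. u y \<partial>\<mu>) / emeasure \<mu> R * emeasure \<mu> R"
      using R(3) by (intro mult_right_mono) auto
    ultimately have "ennreal t * emeasure \<mu> R \<le> (\<integral>\<^sup>+y\<in>R. u y \<partial>\<mu>)" by simp
    with R show "\<exists>R\<in>admissible E orig g \<beta>. x \<in> R \<and> ennreal t * emeasure \<mu> R \<le> (\<integral>\<^sup>+y\<in>R. u y \<partial>\<mu>)"
      by blast
  qed
  have cancel: "ennreal t * a / ennreal t = a" for a
    using True by (subst mult.commute) (simp add: mult_divide_eq_ennreal)
  \<comment> \<open>Dividing by \<open>t\<close> isolates the mass, for which bounds on finite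
    subsets suffice.\<close>
  have "emeasure \<mu> {x. avg_sup \<beta> u x > ennreal t} \<le> ennreal (2 * \<beta>) * (\<integral>\<^sup>+y. u y \<partial>\<mu>) / ennreal t"
  proof (rule emeasure_weight_measure_leI)
    fix F assume "finite F" "F \<subseteq> {x. avg_sup \<beta> u x > ennreal t}"
    from divide_right_mono_ennreal[OF fin[OF this], of "ennreal t"]
    show "emeasure \<mu> F \<le> ennreal (2 * \<beta>) * (\<integral>\<^sup>+y. u y \<partial>\<mu>) / ennreal t"
      by (simp only: cancel)
  qed
  then have "ennreal t * emeasure \<mu> {x. avg_sup \<beta> u x > ennreal t}
     \<le> ennreal t * (ennreal (2 * \<beta>) * (\<integral>\<^sup>+y. u y \<partial>\<mu>) / ennreal t)"
    by (rule mult_left_mono) simp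
  then show ?thesis by (simp only: ennreal_times_divide cancel)
qed (simp add: ennreal_neg)

end

section \<open>Interpolation\<close>

text \<open>The layer-cake integral, used with \<open>a = p\<close> and \<open>a = p - 1\<close>; in
  the latter case the integrand may be unbounded near 0.\<close>

lemma nn_integral_powr_from_0:
  assumes a: "a > 0" and c: "0 \<le> c"
  shows "(\<integral>\<^sup>+t. ennreal (t powr (a - 1)) * indicator {0<..<c} t \<partial>lborel) = ennreal (c powr a / a)"
proof -
  have "((\<lambda>t. t powr (a - 1)) has_integral (c powr (a - 1 + 1) / (a - 1 + 1))) {0..c}"
    using assms by (intro has_integral_powr_from_0) auto
  then have "((\<lambda>t. t powr (a - 1)) has_integral (c powr a / a)) {0<..<c}"
    by (simp add: has_integral_Icc_iff_Ioo)
  then have "((\<lambda>t. if t \<in> {0<..<c} then t powr (a - 1) else 0) has_integral (c powr a / a)) UNIV"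
    by (simp only: has_integral_restrict_UNIV)
  then have "((\<lambda>t. t powr (a - 1) * indicator {0<..<c} t) has_integral (c powr a / a)) UNIV"
    by (rule has_integral_cong[THEN iffD1, rotated]) (auto simp: indicator_def)
  then have "(\<integral>\<^sup>+t. ennreal (t powr (a - 1) * indicator {0<..<c} t) \<partial>lborel) = ennreal (c powr a / a)"
    by (intro nn_integral_has_integral_lborel) auto
  then show ?thesis by (simp add: nn_integral_set_ennreal)
qed

text \<open>Integrability against the weighted counting measure is absolute summability of
  \<open>m x * norm (f x) powr p\<close>, and positive weights do not change the support.\<close>

lemma countable_support_Lp:
  assumes "f \<in> Lp_space p (weight_measure m)" "\<And>x. 0 < m x"
  shows "countable {x. norm (f x) \<noteq> 0}"
proof -
  have "integrable (density (count_space UNIV) (\<lambda>x. ennreal (m x))) (\<lambda>x. norm (f x) powr p)"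
    using assms(1) by (simp add: Lp_space_def weight_measure_def point_measure_def)
  then have "integrable (count_space UNIV) (\<lambda>x. m x *\<^sub>R (norm (f x) powr p))"
    using assms(2) by (subst (asm) integrable_density) (auto intro: less_imp_le)
  then have "Infinite_Set_Sum.abs_summable_on (\<lambda>x. m x * norm (f x) powr p) UNIV"
    by (simp add: Infinite_Set_Sum.abs_summable_on_def)
  then have "(\<lambda>x. norm (m x * norm (f x) powr p)) summable_on UNIV"
    by (rule iffD2[OF abs_summable_equivalent])
  then have "countable {x \<in> UNIV. norm (m x * norm (f x) powr p) \<noteq> 0}"
    by (rule summable_countable_real)
  moreover have "{x \<in> UNIV. norm (m x * norm (f x) powr p) \<noteq> 0} = {x. norm (f x) \<noteq> 0}"
    using assms(2) by (auto simp: less_imp_neq[symmetric])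
  ultimately show ?thesis by simp
qed

lemma nn_integral_weight_measure_support:
  assumes "\<And>x. x \<notin> I \<Longrightarrow> h x = 0"
  shows "(\<integral>\<^sup>+x. h x \<partial>weight_measure m) = (\<integral>\<^sup>+x. ennreal (m x) * h x \<partial>count_space I)"
  unfolding nn_integral_weight_measure
  using assms by (intro nn_integral_count_space_eq) auto

text \<open>
  The weak type bound is integrated against \<open>p * t powr (p - 2)\<close>. Countability of the support of \<open>u\<close> is what
  allows the integrals to be exchanged.
\<close>

lemma strong_type_of_truncated_weak_type:
  fixes m u v :: "'a \<Rightarrow> real"
  assumes p: "p > 1" and B: "B \<ge> 0" and F: "finite F"
    and m: "\<And>x. 0 \<le> m x" and u: "\<And>x. 0 \<le> u x" and v: "\<And>x. x \<in> F \<Longrightarrow> 0 \<le> v x"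
    and I: "countable {y. u y \<noteq> 0}"
    and weak: "\<And>t. t > 0 \<Longrightarrow> ennreal t * emeasure (weight_measure m) {x \<in> F. t < v x}
        \<le> ennreal (2 * B) * (\<integral>\<^sup>+y. ennreal (u y) * indicator {y. t < 2 * u y} y \<partial>weight_measure m)"
  shows "(\<Sum>x\<in>F. ennreal (m x * v x powr p))
    \<le> ennreal (2 powr p * (B * (p / (p - 1)))) * (\<integral>\<^sup>+y. ennreal (u y powr p) \<partial>weight_measure m)"
proof -
  let ?I = "{y. u y \<noteq> 0}" and ?\<mu> = "weight_measure m"
  \<comment> \<open>The exponent stays unsimplified to match \<open>nn_integral_powr_from_0\<close>
    at \<open>a = p - 1\<close>.\<close>
  let ?g = "\<lambda>t y. ennreal (m y * u y) * (ennreal (t powr (p - 1 - 1)) * indicator {0<..<2 * u y} t)"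
  have layer: "ennreal (m x * v x powr p)
      = (\<integral>\<^sup>+t. ennreal (m x * p) * (ennreal (t powr (p - 1)) * indicator {0<..<v x} t) \<partial>lborel)"
    if "x \<in> F" for x
  proof -
    have "ennreal (m x * v x powr p) = ennreal (m x * p) * ennreal (v x powr p / p)"
      using p m[of x] by (simp flip: ennreal_mult)
    then show ?thesis
      using p v[OF that] by (simp add: nn_integral_cmult nn_integral_powr_from_0)
  qed
  \<comment> \<open>One factor \<open>t\<close> of \<open>t powr (p - 1)\<close> is spent on the
    weak type bound at height \<open>t\<close>.\<close>
  have pointwise: "(\<Sum>x\<in>F. ennreal (m x * p) * (ennreal (t powr (p - 1)) * indicator {0<..<v x} t))
      \<le> ennreal (2 * B * p) * (\<integral>\<^sup>+y. ?g t y \<partial>count_space ?I)" for t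
  proof (cases "t > 0")
    case True
    have t: "t powr (p - 1) = t powr (p - 2) * t"
      using True powr_add[of t "p - 2" 1] by simp
    have "(\<Sum>x\<in>F. ennreal (m x * p) * (ennreal (t powr (p - 1)) * indicator {0<..<v x} t))
        = (\<Sum>x\<in>F. ennreal (p * t powr (p - 2)) * (ennreal t * (if t < v x then ennreal (m x) else 0)))"
      using True p m by (intro sum.cong) (auto simp: t mult_ac simp flip: ennreal_mult)
    also have "\<dots> = ennreal (p * t powr (p - 2)) * (ennreal t * emeasure ?\<mu> {x \<in> F. t < v x})"
      using F by (simp add: emeasure_weight_measure_finite sum.inter_filter flip: sum_distrib_left)
    also have "\<dots> \<le> ennreal (p * t powr (p - 2)) * (ennreal (2 * B) *
        (\<integral>\<^sup>+y. ennreal (u y) * indicator {y. t < 2 * u y} y \<partial>?\<mu>))"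
      using weak[OF True] by (rule mult_left_mono) simp
    also have "(\<integral>\<^sup>+y. ennreal (u y) * indicator {y. t < 2 * u y} y \<partial>?\<mu>)
        = (\<integral>\<^sup>+y. ennreal (m y) * (ennreal (u y) * indicator {y. t < 2 * u y} y) \<partial>count_space ?I)"
      by (rule nn_integral_weight_measure_support) simp
    also have "ennreal (p * t powr (p - 2)) * (ennreal (2 * B) * \<dots>)
        = ennreal (2 * B * p) * (ennreal (t powr (p - 2)) * \<dots>)"
      using p B by (simp add: ennreal_mult mult_ac)
    also have "ennreal (t powr (p - 2)) *
        (\<integral>\<^sup>+y. ennreal (m y) * (ennreal (u y) * indicator {y. t < 2 * u y} y) \<partial>count_space ?I)
        = (\<integral>\<^sup>+y. ?g t y \<partial>count_space ?I)"
      using True m u by (subst nn_integral_cmult[symmetric])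
        (auto intro!: nn_integral_cong simp: indicator_def ennreal_mult mult_ac)
    finally show ?thesis .
  qed simp
  have "(\<Sum>x\<in>F. ennreal (m x * v x powr p))
      = (\<integral>\<^sup>+t. (\<Sum>x\<in>F. ennreal (m x * p) * (ennreal (t powr (p - 1)) * indicator {0<..<v x} t)) \<partial>lborel)"
    using layer by (simp add: nn_integral_sum)
  also have "\<dots> \<le> (\<integral>\<^sup>+t. ennreal (2 * B * p) * (\<integral>\<^sup>+y. ?g t y \<partial>count_space ?I) \<partial>lborel)"
    by (intro nn_integral_mono pointwise)
  also have "\<dots> = (\<integral>\<^sup>+t. (\<integral>\<^sup>+y. ennreal (2 * B * p) * ?g t y \<partial>count_space ?I) \<partial>lborel)"
    by (simp add: nn_integral_cmult)
  also have "\<dots> = (\<integral>\<^sup>+y. (\<integral>\<^sup>+t. ennreal (2 * B * p) * ?g t y \<partial>lborel) \<partial>count_space ?I)"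
    using I by (intro nn_integral_count_space_nn_integral) auto
  also have "\<dots> = ennreal (2 * B * p) * (\<integral>\<^sup>+y. (\<integral>\<^sup>+t. ?g t y \<partial>lborel) \<partial>count_space ?I)"
    by (simp add: nn_integral_cmult)
  \<comment> \<open>After the exchange, a fixed \<open>y\<close> only sees the heights below
    \<open>2 * u y\<close>.\<close>
  also have "(\<integral>\<^sup>+y. (\<integral>\<^sup>+t. ?g t y \<partial>lborel) \<partial>count_space ?I)
      = (\<integral>\<^sup>+y. ennreal (m y * u y) * ennreal ((2 * u y) powr (p - 1) / (p - 1)) \<partial>count_space ?I)"
    using p u nn_integral_powr_from_0[of "p - 1"]
    by (intro nn_integral_cong) (simp add: nn_integral_cmult)
  also have "\<dots> = (\<integral>\<^sup>+y. ennreal (2 powr (p - 1) / (p - 1)) * (ennreal (m y) * ennreal (u y powr p))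
      \<partial>count_space ?I)"
  proof (rule nn_integral_cong)
    fix y assume "y \<in> space (count_space ?I)"
    then have "u y > 0" using u[of y] by (simp add: less_le)
    then have "u y powr p = u y * u y powr (p - 1)"
      using powr_add[of "u y" 1 "p - 1"] by simp
    then show "ennreal (m y * u y) * ennreal ((2 * u y) powr (p - 1) / (p - 1))
        = ennreal (2 powr (p - 1) / (p - 1)) * (ennreal (m y) * ennreal (u y powr p))"
      using p m[of y] u[of y] by (simp add: powr_mult mult_ac flip: ennreal_mult)
  qed
  also have "\<dots> = ennreal (2 powr (p - 1) / (p - 1)) * (\<integral>\<^sup>+y. ennreal (u y powr p) \<partial>?\<mu>)"
    using p by (subst nn_integral_weight_measure_support[of ?I]) (auto simp: nn_integral_cmult)
  also have "ennreal (2 * B * p) * \<dots>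
      = ennreal (2 powr p * (B * (p / (p - 1)))) * (\<integral>\<^sup>+y. ennreal (u y powr p) \<partial>?\<mu>)"
  proof -
    have "2 powr p = 2 * 2 powr (p - 1)"
      using powr_add[of 2 1 "p - 1"] by simp
    then have "2 * B * p * (2 powr (p - 1) / (p - 1)) = 2 powr p * (B * (p / (p - 1)))"
      by simp
    moreover have "ennreal (2 * B * p) * ennreal (2 powr (p - 1) / (p - 1))
        = ennreal (2 * B * p * (2 powr (p - 1) / (p - 1)))"
      using p B by (intro ennreal_mult[symmetric]) auto
    ultimately show ?thesis by (metis mult.assoc)
  qed
  finally show ?thesis .
qed

section \<open>Strong type bound for the maximal operator\<close>

context flow_tree
begin

text \<open>Where \<open>t < 2 * u y\<close> fails, \<open>u\<close> is at most \<open>t / 2\<close>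
  and contributes at most \<open>t / 2\<close> to any average. A set whose average exceeds
  \<open>t\<close> thus keeps an average above \<open>t / 2\<close> after truncation.\<close>

lemma avg_sup_truncate:
  assumes t: "t > 0" and x: "ennreal t < avg_sup \<beta> (\<lambda>y. ennreal (u y)) x"
  shows "ennreal (t / 2) < avg_sup \<beta> (\<lambda>y. ennreal (u y) * indicator {y. t < 2 * u y} y) x"
proof -
  let ?u' = "\<lambda>y. ennreal (u y) * indicator {y. t < 2 * u y} y"
  obtain R where R: "R \<in> admissible E orig g \<beta>" "x \<in> R"
    "ennreal t < (\<integral>\<^sup>+y\<in>R. ennreal (u y) \<partial>\<mu>) / emeasure \<mu> R"
    using x unfolding avg_sup_def by (auto simp: less_SUP_iff)
  have pos: "0 < emeasure \<mu> R" "emeasure \<mu> R < \<infinity>"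
    using R(1) emeasure_slab_pos by (metis admissibleE)+
  have "(\<integral>\<^sup>+y\<in>R. ennreal (u y) \<partial>\<mu>) \<le> (\<integral>\<^sup>+y. ?u' y * indicator R y + ennreal (t / 2) * indicator R y \<partial>\<mu>)"
    using t by (intro nn_integral_mono) (auto intro: ennreal_leI split: split_indicator)
  also have "\<dots> = (\<integral>\<^sup>+y\<in>R. ?u' y \<partial>\<mu>) + ennreal (t / 2) * emeasure \<mu> R"
    by (subst nn_integral_add) (auto simp: nn_integral_cmult_indicator)
  finally have "(\<integral>\<^sup>+y\<in>R. ennreal (u y) \<partial>\<mu>) / emeasure \<mu> R
      \<le> ((\<integral>\<^sup>+y\<in>R. ?u' y \<partial>\<mu>) + ennreal (t / 2) * emeasure \<mu> R) / emeasure \<mu> R"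
    by (rule divide_right_mono_ennreal)
  also have "\<dots> = (\<integral>\<^sup>+y\<in>R. ?u' y \<partial>\<mu>) / emeasure \<mu> R + ennreal (t / 2)"
    using pos by (simp add: add_divide_distrib_ennreal mult_divide_eq_ennreal)
  finally have "ennreal t < (\<integral>\<^sup>+y\<in>R. ?u' y \<partial>\<mu>) / emeasure \<mu> R + ennreal (t / 2)"
    using R(3) by simp
  moreover have "ennreal t = ennreal (t / 2) + ennreal (t / 2)"
    using t by (simp flip: ennreal_plus)
  ultimately have "ennreal (t / 2) < (\<integral>\<^sup>+y\<in>R. ?u' y \<partial>\<mu>) / emeasure \<mu> R"
    by (metis add_right_mono not_le)
  then show ?thesis
    using R(1,2) unfolding avg_sup_def by (auto simp: less_SUP_iff)
qed

text \<open>The weak type bound is applied to the truncation at height \<open>t / 2\<close>, which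
  doubles the constant.\<close>

lemma weak_type_truncated:
  assumes "\<beta> \<ge> 1" and t: "t > 0"
  shows "ennreal t * emeasure \<mu> {x. ennreal t < avg_sup \<beta> (\<lambda>y. ennreal (u y)) x}
    \<le> ennreal (2 * (2 * \<beta>)) * (\<integral>\<^sup>+y. ennreal (u y) * indicator {y. t < 2 * u y} y \<partial>\<mu>)"
proof -
  let ?u' = "\<lambda>y. ennreal (u y) * indicator {y. t < 2 * u y} y"
  have "ennreal t * emeasure \<mu> {x. ennreal t < avg_sup \<beta> (\<lambda>y. ennreal (u y)) x}
      \<le> ennreal t * emeasure \<mu> {x. ennreal (t / 2) < avg_sup \<beta> ?u' x}"
    using avg_sup_truncate[OF t] by (intro mult_left_mono emeasure_mono) auto
  also have "\<dots> = 2 * (ennreal (t / 2) * emeasure \<mu> {x. ennreal (t / 2) < avg_sup \<beta> ?u' x})"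
    using t ennreal_mult[of 2 "t / 2"] by (simp add: mult.assoc[symmetric])
  also have "\<dots> \<le> 2 * (ennreal (2 * \<beta>) * (\<integral>\<^sup>+y. ?u' y \<partial>\<mu>))"
    by (intro mult_left_mono weak_type assms) simp
  also have "\<dots> = ennreal (2 * (2 * \<beta>)) * (\<integral>\<^sup>+y. ?u' y \<partial>\<mu>)"
    using assms ennreal_mult[of 2 "2 * \<beta>"] by (simp add: mult.assoc[symmetric])
  finally show ?thesis .
qed

text \<open>Real lower bounds \<open>v\<close> replace the maximal function, whose finiteness is not
  yet known and is itself derived from this bound.\<close>

lemma strong_type_finite:
  assumes \<beta>: "\<beta> \<ge> 1" and p: "p > 1" and f: "f \<in> Lp_space p \<mu>" and F: "finite F"
    and v: "\<And>x. x \<in> F \<Longrightarrow> 0 \<le> v x" "\<And>x. x \<in> F \<Longrightarrow> ennreal (v x) \<le> avg_sup \<beta> (\<lambda>y. ennreal (norm (f y))) x"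
  shows "(\<Sum>x\<in>F. ennreal (m x * v x powr p))
    \<le> ennreal (2 powr p * (2 * \<beta> * (p / (p - 1))) * (\<integral>y. norm (f y) powr p \<partial>\<mu>))"
proof -
  have "(\<Sum>x\<in>F. ennreal (m x * v x powr p))
    \<le> ennreal (2 powr p * (2 * \<beta> * (p / (p - 1)))) * (\<integral>\<^sup>+y. ennreal (norm (f y) powr p) \<partial>\<mu>)"
  proof (rule strong_type_of_truncated_weak_type[OF p _ F _ _ v(1)])
    fix t :: real assume t: "t > 0"
    have "{x \<in> F. t < v x} \<subseteq> {x. ennreal t < avg_sup \<beta> (\<lambda>y. ennreal (norm (f y))) x}"
    proof safe
      fix x assume "x \<in> F" "t < v x"
      then have "ennreal t < ennreal (v x)" using t by (simp add: ennreal_less_iff)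
      also have "\<dots> \<le> avg_sup \<beta> (\<lambda>y. ennreal (norm (f y))) x" using \<open>x \<in> F\<close> by (rule v(2))
      finally show "ennreal t < avg_sup \<beta> (\<lambda>y. ennreal (norm (f y))) x" .
    qed
    then have "ennreal t * emeasure \<mu> {x \<in> F. t < v x}
        \<le> ennreal t * emeasure \<mu> {x. ennreal t < avg_sup \<beta> (\<lambda>y. ennreal (norm (f y))) x}"
      by (intro mult_left_mono emeasure_mono) auto
    also note weak_type_truncated[OF \<beta> t]
    finally show "ennreal t * emeasure \<mu> {x \<in> F. t < v x} \<le> ennreal (2 * (2 * \<beta>)) *
        (\<integral>\<^sup>+y. ennreal (norm (f y)) * indicator {y. t < 2 * norm (f y)} y \<partial>\<mu>)" .
  next
    show "countable {y. norm (f y) \<noteq> 0}" using f m_pos by (rule countable_support_Lp)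
  qed (use \<beta> m_pos in \<open>auto intro: less_imp_le\<close>)
  also have "(\<integral>\<^sup>+y. ennreal (norm (f y) powr p) \<partial>\<mu>) = ennreal (\<integral>y. norm (f y) powr p \<partial>\<mu>)"
    using f by (intro nn_integral_eq_integral) (auto simp: Lp_space_def)
  finally show ?thesis using \<beta> p by (simp flip: ennreal_mult)
qed

lemma avg_sup_finite:
  assumes \<beta>: "\<beta> \<ge> 1" and p: "p > 1" and f: "f \<in> Lp_space p \<mu>"
  shows "avg_sup \<beta> (\<lambda>y. ennreal (norm (f y))) x < \<infinity>"
proof (rule ccontr)
  define C where "C = 2 powr p * (2 * \<beta> * (p / (p - 1))) * (\<integral>y. norm (f y) powr p \<partial>\<mu>)"
  assume "\<not> ?thesis"
  then have top: "avg_sup \<beta> (\<lambda>y. ennreal (norm (f y))) x = \<infinity>"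
    by (metis infinity_ennreal_def top.not_eq_extremum)
  have C: "C \<ge> 0" using \<beta> p by (simp add: C_def)
  \<comment> \<open>If the supremum at \<open>x\<close> is infinite, every real is a lower bound
    there; this one makes \<open>m x * T powr p\<close> equal to \<open>C + m x\<close>, which
    exceeds \<open>C\<close>.\<close>
  define T where "T = (C / m x + 1) powr (1 / p)"
  have "ennreal (m x * T powr p) \<le> ennreal C"
    using strong_type_finite[OF \<beta> p f, of "{x}" "\<lambda>_. T"] top by (simp add: T_def C_def)
  then have "m x * T powr p \<le> C" using C by (simp add: ennreal_le_iff)
  moreover have "T powr p = C / m x + 1"
  proof -
    have "C / m x + 1 \<ge> 0" using C m_pos[of x] by (intro add_nonneg_nonneg divide_nonneg_pos) simp_all
    then show ?thesis using p by (simp add: T_def powr_powr del: times_divide_eq_right)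
  qed
  then have "m x * T powr p = C + m x" using m_pos[of x] by (simp add: field_simps)
  ultimately show False using m_pos[of x] by linarith
qed

lemma strong_type:
  assumes \<beta>: "\<beta> \<ge> 1" and p: "p > 1" and f: "f \<in> Lp_space p \<mu>"
  defines "v \<equiv> \<lambda>x. enn2real (avg_sup \<beta> (\<lambda>y. ennreal (norm (f y))) x)"
  shows "v \<in> Lp_space p \<mu>"
    and "Lp_norm p \<mu> v \<le> 2 * (2 * \<beta> * (p / (p - 1))) powr (1 / p) * Lp_norm p \<mu> f"
proof -
  let ?N = "\<integral>y. norm (f y) powr p \<partial>\<mu>"
  let ?C = "2 powr p * (2 * \<beta> * (p / (p - 1))) * ?N"
  \<comment> \<open>By finiteness, \<open>enn2real\<close> never falls back to its value 0 at
    infinity.\<close>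
  have v: "0 \<le> v x" "ennreal (v x) \<le> avg_sup \<beta> (\<lambda>y. ennreal (norm (f y))) x" for x
    using avg_sup_finite[OF \<beta> p f, of x] by (simp_all add: v_def)
  have C: "?C \<ge> 0" using \<beta> p by simp
  have "(\<integral>\<^sup>+x. ennreal (norm (v x) powr p) \<partial>\<mu>) \<le> ennreal ?C"
    unfolding nn_integral_weight_measure
  proof (rule nn_integral_count_space_leI)
    fix F :: "'v set" assume "finite F"
    from strong_type_finite[OF \<beta> p f this, of v] v
    show "(\<Sum>x\<in>F. ennreal (m x) * ennreal (norm (v x) powr p)) \<le> ennreal ?C"
      using m_pos by (simp add: ennreal_mult less_imp_le)
  qed
  note bound = this
  have int: "integrable \<mu> (\<lambda>x. norm (v x) powr p)"
    using bound by (intro integrableI_bounded) (auto simp: le_less_trans)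
  then show "v \<in> Lp_space p \<mu>" by (simp add: Lp_space_def)
  have "ennreal (\<integral>x. norm (v x) powr p \<partial>\<mu>) \<le> ennreal ?C"
    using bound int by (subst nn_integral_eq_integral[symmetric]) auto
  then have "(\<integral>x. norm (v x) powr p \<partial>\<mu>) \<le> ?C" using C by (simp add: ennreal_le_iff)
  then have "Lp_norm p \<mu> v \<le> ?C powr (1 / p)"
    unfolding Lp_norm_def using p by (intro powr_mono2) auto
  also have "\<dots> = (2 powr p) powr (1 / p) * (2 * \<beta> * (p / (p - 1))) powr (1 / p) * ?N powr (1 / p)"
    using \<beta> p by (simp only: powr_mult)
  also have "(2 powr p) powr (1 / p) = 2" using p by (simp add: powr_powr)
  finally show "Lp_norm p \<mu> v \<le> 2 * (2 * \<beta> * (p / (p - 1))) powr (1 / p) * Lp_norm p \<mu> f"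
    by (simp add: Lp_norm_def)
qed

lemma weak_type_real:
  assumes \<beta>: "\<beta> \<ge> 1" and f: "f \<in> Lp_space 1 \<mu>" and t: "t > 0"
  shows "emeasure \<mu> {x. avg_sup \<beta> (\<lambda>y. ennreal (norm (f y))) x > ennreal t}
    \<le> ennreal (2 * \<beta> / t * Lp_norm 1 \<mu> f)" (is "?e \<le> _")
proof -
  have "(\<integral>\<^sup>+y. ennreal (norm (f y)) \<partial>\<mu>) = ennreal (Lp_norm 1 \<mu> f)"
    using f by (subst nn_integral_eq_integral) (auto simp: Lp_space_def Lp_norm_def)
  then have "ennreal t * ?e \<le> ennreal (2 * \<beta>) * ennreal (Lp_norm 1 \<mu> f)"
    using weak_type[OF \<beta>, of t "\<lambda>y. ennreal (norm (f y))"] by simp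
  then have "ennreal (1 / t) * (ennreal t * ?e)
      \<le> ennreal (1 / t) * (ennreal (2 * \<beta>) * ennreal (Lp_norm 1 \<mu> f))"
    by (rule mult_left_mono) simp
  moreover have "ennreal (1 / t) * (ennreal t * ?e) = ?e"
    using t by (simp add: mult.assoc[symmetric] flip: ennreal_mult)
  moreover have "ennreal (1 / t) * (ennreal (2 * \<beta>) * ennreal (Lp_norm 1 \<mu> f))
      = ennreal (2 * \<beta> / t * Lp_norm 1 \<mu> f)"
    using t \<beta> by (simp add: Lp_norm_def flip: ennreal_mult)
  ultimately show ?thesis by simp
qed

end

theorem theorem3p3:
  fixes E :: "('v \<times> 'v) set" and orig :: 'v and g :: "nat \<Rightarrow> 'v"
    and m :: "'v \<Rightarrow> real" and \<beta> :: real
  assumes "undirected_tree E"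
    and "geodesic_ray E orig g"
    and "flow E orig g m"
    and "locally_doubling E m"
    and "\<beta> \<ge> 12"
  shows "(\<forall>f \<in> Lp_space 1 (weight_measure m). \<forall>t::real. t > 0 \<longrightarrow>
            emeasure (weight_measure m) {x. maximal_function E orig g m \<beta> f x > ennreal t}
              \<le> ennreal (2 * \<beta> / t * Lp_norm 1 (weight_measure m) f))
       \<and> (\<forall>p::real. p > 1 \<longrightarrow> (\<forall>f \<in> Lp_space p (weight_measure m).
            (\<forall>x. maximal_function E orig g m \<beta> f x < \<infinity>) \<and>
            (\<lambda>x. enn2real (maximal_function E orig g m \<beta> f x)) \<in> Lp_space p (weight_measure m) \<and>
            Lp_norm p (weight_measure m) (\<lambda>x. enn2real (maximal_function E orig g m \<beta> f x))
              \<le> 2 * (2 * \<beta> * (p / (p - 1))) powr (1 / p) * Lp_norm p (weight_measure m) f))"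
proof -
  interpret flow_tree E orig g m
    using assms(1-3) by unfold_locales
  have \<beta>: "\<beta> \<ge> 1" using assms(5) by simp
  show ?thesis
    unfolding maximal_function_eq_avg_sup
    using weak_type_real[OF \<beta>] avg_sup_finite[OF \<beta>] strong_type[OF \<beta>] by blast
qed

end
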